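(* Let $f \in \mathcal{S}_S^*$, $f(z)=z+\sum_{n=2}^{\infty}a_nz^n$, and let $\Gamma_1,\Gamma_2$ be the first two inverse logarithmic coefficients of $f$. Then $$|\Gamma_2|-|\Gamma_1|\le \frac12 .$$ The inequality is sharp, i.e. there exists $f\in\mathcal{S}_S^*$ for which equality holds.
   Context: Let $\mathbb{D}=\{z\in\mathbb{C}:|z|<1\}$. $\mathcal{A}$ denotes the class of functions $f$ analytic in $\mathbb{D}$ with $f(0)=0$ and $f'(0)=1$, so $f(z)=z+\sum_{n=2}^\infty a_n z^n$. The class $\mathcal{S}_S^*$ (starlike functions with respect to symmetric points) consists of all $f\in\mathcal{A}$ such that $$\operatorname{Re}\left(\frac{zf'(z)}{f(z)-f(-z)}\right)>0,\qquad z\in\mathbb{D},$$ where the quotient at $z=0$ is understood as its limit, $1/2$. For $f\in\mathcal{A}$, let $f^{-1}$ be its local inverse near the origin with $f^{-1}(0)=0$. The inverse logarithmic coefficients $\Gamma_n$ of $f$ are defined by $$\log\frac{f^{-1}(w)}{w}=2\sum_{n=1}^\infty \Gamma_n w^n$$ for $w$ in a neighborhood of $0$, with the branch of the logarithm satisfying $\log 1=0$. In terms of the Taylor coefficients of $f$, $\Gamma_1=-\frac12 a_2$ and $\Gamma_2=-\frac12 a_3+\frac34 a_2^2$. *)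

theory Defs
  imports "HOL-Complex_Analysis.Complex_Analysis"
begin

definition class_A :: "(complex \<Rightarrow> complex) set" where
  "class_A = {f. f holomorphic_on ball 0 1 \<and> f 0 = 0 \<and> deriv f 0 = 1}"

text \<open>
  The value \<open>1/2\<close> at the origin is the limit of the quotient, see \<open>starlike_sym_quot_limit\<close>.
  Away from the origin the condition forces \<open>f z \<noteq> f (- z)\<close>, because a quotient
  with denominator \<open>0\<close> is \<open>0\<close> and its real part is not positive.
\<close>

definition starlike_sym_quot :: "(complex \<Rightarrow> complex) \<Rightarrow> complex \<Rightarrow> complex" where
  "starlike_sym_quot f z = (if z = 0 then 1/2 else z * deriv f z / (f z - f (- z)))"

definition starlike_sym :: "(complex \<Rightarrow> complex) set" where
  "starlike_sym = {f \<in> class_A. \<forall>z\<in>ball 0 1. Re (starlike_sym_quot f z) > 0}"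

definition local_inverse_at_0 :: "(complex \<Rightarrow> complex) \<Rightarrow> (complex \<Rightarrow> complex) \<Rightarrow> bool" where
  "local_inverse_at_0 f g \<longleftrightarrow> g analytic_on {0} \<and> g 0 = 0 \<and>
     (\<forall>\<^sub>F w in nhds 0. f (g w) = w) \<and> (\<forall>\<^sub>F z in nhds 0. g (f z) = z)"

text \<open>
  For \<open>f\<close> in \<open>class_A\<close> the quotient \<open>g w / w\<close> tends to \<open>1\<close> as \<open>w\<close> tends to \<open>0\<close>, so near the
  origin the branch of the logarithm with \<open>log 1 = 0\<close> is the principal one.  The series starts at
  \<open>n = 1\<close>, which is encoded by the condition \<open>\<Gamma> 0 = 0\<close>.
\<close>

definition has_inv_log_coeffs :: "(complex \<Rightarrow> complex) \<Rightarrow> (nat \<Rightarrow> complex) \<Rightarrow> bool" where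
  "has_inv_log_coeffs f \<Gamma> \<longleftrightarrow> \<Gamma> 0 = 0 \<and>
     (\<exists>g. local_inverse_at_0 f g \<and>
          (\<forall>\<^sub>F w in at 0. (\<lambda>n. 2 * \<Gamma> n * w ^ n) sums Ln (g w / w)))"

text \<open>
  The description is proper for \<open>f\<close> in \<open>class_A\<close>, see \<open>inv_log_coeffs_ex1\<close>.
\<close>

definition inv_log_coeff :: "(complex \<Rightarrow> complex) \<Rightarrow> nat \<Rightarrow> complex" where
  "inv_log_coeff f = (THE \<Gamma>. has_inv_log_coeffs f \<Gamma>)"

lemma starlike_sym_quot_limit:
  assumes "f \<in> class_A"
  shows "((\<lambda>z. z * deriv f z / (f z - f (- z))) \<longlongrightarrow> 1/2) (at 0)"
proof -
  have hol: "f holomorphic_on ball 0 1" and f0: "f 0 = 0" and d0: "deriv f 0 = 1"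
    using assms by (auto simp: class_A_def)
  have D: "(f has_field_derivative 1) (at 0)"
    using holomorphic_derivI[OF hol, of 0] d0 by simp
  have "((\<lambda>z. f z - f (- z)) has_field_derivative 2) (at 0)"
    using D by (auto intro!: derivative_eq_intros DERIV_chain2[where f = f])
  then have q: "((\<lambda>z. (f z - f (- z)) / z) \<longlongrightarrow> 2) (at 0)"
    using f0 by (simp add: has_field_derivative_iff)
  have "isCont (deriv f) 0"
    using holomorphic_deriv[OF hol] holomorphic_on_imp_continuous_on
      continuous_on_eq_continuous_at[of "ball 0 1" "deriv f"] by auto
  then have "(deriv f \<longlongrightarrow> 1) (at 0)"
    using d0 by (simp add: isCont_def)
  from tendsto_divide[OF this q]
  have "((\<lambda>z. deriv f z / ((f z - f (- z)) / z)) \<longlongrightarrow> 1/2) (at 0)" by simp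
  then show ?thesis by (simp add: mult.commute)
qed

lemma local_inverse_exists:
  assumes "f \<in> class_A"
  obtains g where "local_inverse_at_0 f g"
proof -
  have hol: "f holomorphic_on ball 0 1" and f0: "f 0 = 0" and d0: "deriv f 0 = 1"
    using assms by (auto simp: class_A_def)
  obtain r where r: "r > 0" "ball 0 r \<subseteq> ball (0::complex) 1" "open (f ` ball 0 r)" "inj_on f (ball 0 r)"
    using has_complex_derivative_locally_invertible[OF hol, of 0] d0 by auto
  have holr: "f holomorphic_on ball 0 r"
    using hol r(2) holomorphic_on_subset by blast
  obtain g where g: "g holomorphic_on f ` ball 0 r" "\<And>z. z \<in> ball 0 r \<Longrightarrow> g (f z) = z"
    using holomorphic_has_inverse[OF holr open_ball r(4)] by metis
  have mem: "0 \<in> f ` ball 0 r"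
    using r(1) f0 by (metis centre_in_ball image_eqI)
  have "g analytic_on {0}"
    using g(1) r(3) mem analytic_at by blast
  moreover have "g 0 = 0"
    using g(2)[of 0] r(1) f0 by simp
  moreover have "\<forall>\<^sub>F w in nhds 0. f (g w) = w"
    unfolding eventually_nhds using r(3) mem g(2) by (intro exI[of _ "f ` ball 0 r"]) auto
  moreover have "\<forall>\<^sub>F z in nhds 0. g (f z) = z"
    unfolding eventually_nhds using r(1) g(2) by (intro exI[of _ "ball 0 r"]) auto
  ultimately show ?thesis
    using that by (simp add: local_inverse_at_0_def)
qed

lemma local_inverse_unique:
  assumes "local_inverse_at_0 f g" "local_inverse_at_0 f h"
  shows "\<forall>\<^sub>F w in nhds 0. g w = h w"
proof -
  have "isCont h 0" "h 0 = 0"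
    using assms(2) analytic_at_imp_isCont by (auto simp: local_inverse_at_0_def)
  then have "filterlim h (nhds 0) (nhds 0)"
    by (metis isCont_def tendsto_at_iff_tendsto_nhds)
  then have "\<forall>\<^sub>F w in nhds 0. g (f (h w)) = h w"
    using assms(1) by (auto simp: local_inverse_at_0_def filterlim_iff)
  moreover have "\<forall>\<^sub>F w in nhds 0. f (h w) = w"
    using assms(2) by (simp add: local_inverse_at_0_def)
  ultimately show ?thesis
    by eventually_elim simp
qed

lemma local_inverse_deriv:
  assumes "f \<in> class_A" "local_inverse_at_0 f g"
  shows "deriv g 0 = 1"
proof -
  have "(f has_field_derivative 1) (at 0)"
    using assms(1) holomorphic_derivI[of f "ball 0 1" 0] by (auto simp: class_A_def)
  moreover have "(g has_field_derivative deriv g 0) (at 0)" and "g 0 = 0"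
    using assms(2) analytic_on_imp_differentiable_at[of g "{0}" 0] field_differentiable_derivI
    by (auto simp: local_inverse_at_0_def)
  ultimately have "((\<lambda>w. f (g w)) has_field_derivative 1 * deriv g 0) (at 0)"
    using DERIV_chain2[of f 1 g 0] by simp
  moreover have "((\<lambda>w. f (g w)) has_field_derivative 1) (at 0)"
    using assms(2) DERIV_cong_ev[of 0 0 "\<lambda>w. f (g w)" "\<lambda>w. w" 1 1]
    by (simp add: local_inverse_at_0_def)
  ultimately show ?thesis
    using DERIV_unique by force
qed

lemma inv_log_coeffs_ex1:
  assumes "f \<in> class_A"
  shows "\<exists>!\<Gamma>. has_inv_log_coeffs f \<Gamma>"
proof (rule ex_ex1I)
  obtain g where g: "local_inverse_at_0 f g"
    using local_inverse_exists[OF assms] .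
  obtain S where S: "open S" "0 \<in> S" "g holomorphic_on S"
    using g analytic_at by (auto simp: local_inverse_at_0_def)
  have g0: "g 0 = 0" using g by (simp add: local_inverse_at_0_def)
  define q where "q = (\<lambda>w. if w = 0 then 1 else g w / w)"
  have "q holomorphic_on S"
    using pole_theorem_open_0[OF S(3,1), of 0 q] local_inverse_deriv[OF assms g] g0
    by (simp add: q_def)
  then have qa: "q analytic_on {0}"
    using S analytic_at by blast
  have "(\<lambda>w. Ln (q w)) analytic_on {0}"
    using qa by (intro analytic_intros) (auto simp: q_def)
  then have "(\<lambda>w. Ln (q w)) has_fps_expansion fps_expansion (\<lambda>w. Ln (q w)) 0"
    by (rule analytic_at_imp_has_fps_expansion_0)
  then obtain F where F: "(\<lambda>w. Ln (q w)) has_fps_expansion F" by blast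
  have ev: "\<forall>\<^sub>F w in nhds 0. (\<lambda>n. fps_nth F n * w ^ n) sums Ln (q w)"
  proof -
    have "\<forall>\<^sub>F w in nhds 0. ereal (cmod w) < fps_conv_radius F"
      using F eventually_nhds_in_open[OF open_eball, of "0::complex" 0 "fps_conv_radius F"]
      by (simp add: has_fps_expansion_def dist_norm zero_ereal_def)
    moreover have "\<forall>\<^sub>F w in nhds 0. eval_fps F w = Ln (q w)"
      using F by (simp add: has_fps_expansion_def)
    ultimately show ?thesis
      by eventually_elim (metis sums_eval_fps)
  qed
  have "fps_nth F 0 = 0"
    using has_fps_expansion_imp_0_eq_fps_nth_0[OF F] by (simp add: q_def)
  moreover have "\<forall>\<^sub>F w in at 0. (\<lambda>n. 2 * (fps_nth F n / 2) * w ^ n) sums Ln (g w / w)"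
    using ev unfolding eventually_at_filter by eventually_elim (auto simp: q_def)
  ultimately have "has_inv_log_coeffs f (\<lambda>n. fps_nth F n / 2)"
    using g by (auto simp: has_inv_log_coeffs_def)
  then show "\<exists>\<Gamma>. has_inv_log_coeffs f \<Gamma>" by blast
next
  fix \<Gamma> \<Delta> assume "has_inv_log_coeffs f \<Gamma>" "has_inv_log_coeffs f \<Delta>"
  then obtain g h where g: "local_inverse_at_0 f g"
      "\<forall>\<^sub>F w in at 0. (\<lambda>n. 2 * \<Gamma> n * w ^ n) sums Ln (g w / w)"
    and h: "local_inverse_at_0 f h"
      "\<forall>\<^sub>F w in at 0. (\<lambda>n. 2 * \<Delta> n * w ^ n) sums Ln (h w / w)"
    and z: "\<Gamma> 0 = 0" "\<Delta> 0 = 0"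
    by (auto simp: has_inv_log_coeffs_def)
  define k where "k = (\<lambda>w. if w = 0 then 0 else Ln (g w / w))"
  have zero: "(\<lambda>n. c n * 0 ^ n) sums 0" if "c 0 = 0" for c :: "nat \<Rightarrow> complex"
    using sums_If_finite[of "\<lambda>n. n = 0" c] powser_sums_zero[of c] that by simp
  have "\<forall>\<^sub>F w in nhds 0. (\<lambda>n. fps_nth (Abs_fps (\<lambda>n. 2 * \<Gamma> n)) n * w ^ n) sums k w"
    using g(2) unfolding eventually_at_filter
    by eventually_elim (use z zero[of "\<lambda>n. 2 * \<Gamma> n"] in \<open>auto simp: k_def\<close>)
  then have 1: "k has_fps_expansion Abs_fps (\<lambda>n. 2 * \<Gamma> n)"
    by (rule has_fps_expansionI)
  have "\<forall>\<^sub>F w in nhds 0. (\<lambda>n. fps_nth (Abs_fps (\<lambda>n. 2 * \<Delta> n)) n * w ^ n) sums k w"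
    using h(2) local_inverse_unique[OF g(1) h(1)] unfolding eventually_at_filter
    by eventually_elim (use z zero[of "\<lambda>n. 2 * \<Delta> n"] in \<open>auto simp: k_def\<close>)
  then have 2: "k has_fps_expansion Abs_fps (\<lambda>n. 2 * \<Delta> n)"
    by (rule has_fps_expansionI)
  from fps_expansion_unique_complex[OF 1 2] show "\<Gamma> = \<Delta>"
    by (simp add: fps_eq_iff fun_eq_iff)
qed

lemma has_inv_log_coeffs_inv_log_coeff:
  assumes "f \<in> class_A"
  shows "has_inv_log_coeffs f (inv_log_coeff f)"
  unfolding inv_log_coeff_def by (rule theI'[OF inv_log_coeffs_ex1[OF assms]])

end

theory Submission
  imports Defs
begin

text \<open>
  Write \<open>f z = z + a\<^sub>2 z\<^sup>2 + a\<^sub>3 z\<^sup>3 + \<dots>\<close>, and let \<open>q z = (f z - f (- z)) / (2 z)\<close> be the odd part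
  of \<open>f\<close> divided by \<open>z\<close>, so \<open>q z = 1 + a\<^sub>3 z\<^sup>2 + \<dots>\<close>.  Starlikeness with respect to symmetric
  points says that \<open>f' / q\<close> has positive real part, hence its Cayley transform
  \<open>\<phi> = (f' - q) / (f' + q)\<close> maps the unit disc into its closure.  Comparing coefficients in
  \<open>\<phi> (f' + q) = f' - q\<close> gives \<open>\<phi> z = a\<^sub>2 z + (a\<^sub>3 - a\<^sub>2\<^sup>2) z\<^sup>2 + \<dots>\<close>, and Cauchy's estimate yields
  \<open>\<bar>a\<^sub>2\<bar> \<le> 1\<close> and \<open>\<bar>a\<^sub>3 - a\<^sub>2\<^sup>2\<bar> \<le> 1\<close> (lemma \<open>starlike_sym_coeff_bounds\<close>).

  Comparing coefficients in \<open>f z * exp (\<Sum>n. 2 \<Gamma>\<^sub>n (f z)\<^sup>n) = z\<close> gives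
  \<open>\<Gamma>\<^sub>1 = - a\<^sub>2 / 2\<close> and \<open>\<Gamma>\<^sub>2 = - a\<^sub>3 / 2 + 3 a\<^sub>2\<^sup>2 / 4 = - (a\<^sub>3 - a\<^sub>2\<^sup>2) / 2 + a\<^sub>2\<^sup>2 / 4\<close>
  (lemma \<open>inv_log_coeff_1_2\<close>).  With \<open>x = \<bar>a\<^sub>2\<bar> \<le> 1\<close> therefore
  \<open>\<bar>\<Gamma>\<^sub>2\<bar> - \<bar>\<Gamma>\<^sub>1\<bar> \<le> 1/2 + x\<^sup>2 / 4 - x / 2 \<le> 1/2\<close>.  Equality holds for \<open>f z = z / (1 - z\<^sup>2)\<close>,
  where \<open>\<phi> z = z\<^sup>2\<close>, \<open>a\<^sub>2 = 0\<close> and \<open>a\<^sub>3 = 1\<close>.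
\<close>

section \<open>Inverse logarithmic coefficients in terms of Taylor coefficients\<close>

lemma class_A_has_fps_expansion:
  assumes "f \<in> class_A"
  shows "f has_fps_expansion fps_expansion f 0"
    and "fps_nth (fps_expansion f 0) 0 = 0"
    and "fps_nth (fps_expansion f 0) 1 = 1"
proof -
  have "f analytic_on {0}"
    using assms by (auto simp: class_A_def analytic_at intro!: exI[of _ "ball 0 1"])
  then show "f has_fps_expansion fps_expansion f 0"
    by (rule analytic_at_imp_has_fps_expansion_0)
  show "fps_nth (fps_expansion f 0) 0 = 0" "fps_nth (fps_expansion f 0) 1 = 1"
    using assms by (auto simp: class_A_def fps_expansion_def)
qed

text \<open>
  This is \<open>g (w) = w * exp (\<Sum>n. 2 \<Gamma>\<^sub>n w\<^sup>n)\<close> for the local inverse \<open>g\<close>, composed with \<open>f\<close> so that only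
  the expansion of \<open>f\<close> itself enters.
\<close>

lemma inv_log_coeff_fps_identity:
  assumes f: "f \<in> class_A" and F: "f has_fps_expansion F"
  shows "F * (fps_exp 1 oo (Abs_fps (\<lambda>n. 2 * inv_log_coeff f n) oo F)) = fps_X"
proof -
  define \<Gamma> where "\<Gamma> = inv_log_coeff f"
  obtain g where g: "local_inverse_at_0 f g"
      "\<forall>\<^sub>F w in at 0. (\<lambda>n. 2 * \<Gamma> n * w ^ n) sums Ln (g w / w)" and \<Gamma>0: "\<Gamma> 0 = 0"
    using has_inv_log_coeffs_inv_log_coeff[OF f] by (auto simp: has_inv_log_coeffs_def \<Gamma>_def)
  define k where "k = (\<lambda>w. if w = 0 then 0 else Ln (g w / w))"
  have f0: "f 0 = 0" using f by (simp add: class_A_def)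
  have F0: "fps_nth F 0 = 0"
    using has_fps_expansion_imp_0_eq_fps_nth_0[OF F] f0 by simp
  have zero: "(\<lambda>n. 2 * \<Gamma> n * 0 ^ n) sums 0"
    using powser_sums_zero[of "\<lambda>n. 2 * \<Gamma> n"] \<Gamma>0 by simp
  have "\<forall>\<^sub>F w in nhds 0. (\<lambda>n. fps_nth (Abs_fps (\<lambda>n. 2 * \<Gamma> n)) n * w ^ n) sums k w"
    using g(2) unfolding eventually_at_filter
    by eventually_elim (use zero in \<open>auto simp: k_def\<close>)
  then have K: "k has_fps_expansion Abs_fps (\<lambda>n. 2 * \<Gamma> n)"
    by (rule has_fps_expansionI)
  have kf: "(k \<circ> f) has_fps_expansion (Abs_fps (\<lambda>n. 2 * \<Gamma> n) oo F)"
    using K F F0 by (rule has_fps_expansion_compose)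
  have "(exp \<circ> (k \<circ> f)) has_fps_expansion (fps_exp 1 oo (Abs_fps (\<lambda>n. 2 * \<Gamma> n) oo F))"
    using has_fps_expansion_exp[of 1] \<Gamma>0
    by (intro has_fps_expansion_compose[OF _ kf]) auto
  from has_fps_expansion_mult[OF F this]
  have 1: "(\<lambda>z. f z * exp (k (f z))) has_fps_expansion
      F * (fps_exp 1 oo (Abs_fps (\<lambda>n. 2 * \<Gamma> n) oo F))"
    by (simp add: o_def)
  have "\<forall>\<^sub>F z in nhds 0. g (f z) = z"
    using g(1) by (simp add: local_inverse_at_0_def)
  moreover have "g 0 = 0"
    using g(1) by (simp add: local_inverse_at_0_def)
  ultimately have "\<forall>\<^sub>F z in nhds 0. f z * exp (k (f z)) = z"
  proof (elim eventually_mono)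
    fix z assume z: "g (f z) = z"
    show "f z * exp (k (f z)) = z"
    proof (cases "f z = 0")
      case True
      then show ?thesis using z \<open>g 0 = 0\<close> by simp
    next
      case False
      then have "z \<noteq> 0" using f0 by auto
      then show ?thesis using False z by (simp add: k_def)
    qed
  qed
  with 1 have "(\<lambda>z. z) has_fps_expansion F * (fps_exp 1 oo (Abs_fps (\<lambda>n. 2 * \<Gamma> n) oo F))"
    using has_fps_expansion_cong by fastforce
  from fps_expansion_unique_complex[OF this has_fps_expansion_fps_X]
  show ?thesis by (simp add: \<Gamma>_def)
qed

lemma fps_compose_nth_1_2:
  fixes A B :: "'a::comm_ring_1 fps"
  assumes "fps_nth B 0 = 0"
  shows "fps_nth (A oo B) 1 = fps_nth A 1 * fps_nth B 1"
    and "fps_nth (A oo B) 2 = fps_nth A 1 * fps_nth B 2 + fps_nth A 2 * fps_nth B 1 ^ 2"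
  using assms
  by (simp_all add: fps_compose_nth numeral_2_eq_2 fps_mult_nth power2_eq_square)

lemma inv_log_coeff_1_2:
  assumes f: "f \<in> class_A" and F: "f has_fps_expansion F"
  shows "inv_log_coeff f 1 = - fps_nth F 2 / 2"
    and "inv_log_coeff f 2 = - fps_nth F 3 / 2 + 3/4 * (fps_nth F 2)\<^sup>2"
proof -
  have "F = fps_expansion f 0"
    using fps_expansion_unique_complex[OF F class_A_has_fps_expansion(1)[OF f]] .
  then have F0: "fps_nth F 0 = 0" and F1: "fps_nth F 1 = 1"
    using class_A_has_fps_expansion[OF f] by auto
  define H where "H = Abs_fps (\<lambda>n. 2 * inv_log_coeff f n)"
  define E where "E = fps_exp 1 oo (H oo F)"
  have H: "fps_nth H 0 = 0"
    using has_inv_log_coeffs_inv_log_coeff[OF f] by (simp add: H_def has_inv_log_coeffs_def)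
  have HF: "fps_nth (H oo F) 0 = 0" by (simp add: H)
  have E0: "fps_nth E 0 = 1" by (simp add: E_def)
  have E1: "fps_nth E 1 = fps_nth H 1"
    using fps_compose_nth_1_2(1)[OF HF, of "fps_exp 1"] fps_compose_nth_1_2(1)[OF F0, of H] F1
    by (simp add: E_def)
  have E2: "fps_nth E 2 = fps_nth H 1 * fps_nth F 2 + fps_nth H 2 + fps_nth H 1 ^ 2 / 2"
    using fps_compose_nth_1_2(2)[OF HF, of "fps_exp 1"] fps_compose_nth_1_2[OF F0, of H] F1
    by (simp add: E_def)
  have eq: "F * E = fps_X"
    using inv_log_coeff_fps_identity[OF f F] by (simp add: E_def H_def)
  have "fps_nth (F * E) 2 = fps_nth F 2 + fps_nth E 1"
    using F0 F1 E0 by (simp add: fps_mult_nth numeral_2_eq_2)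
  then have 1: "fps_nth H 1 = - fps_nth F 2"
    using E1 by (simp add: eq add_eq_0_iff)
  have "fps_nth (F * E) 3 = fps_nth F 3 + fps_nth F 2 * fps_nth E 1 + fps_nth E 2"
    using F0 F1 E0 by (simp add: fps_mult_nth numeral_2_eq_2 numeral_3_eq_3)
  then have 2: "fps_nth F 3 + fps_nth F 2 * fps_nth H 1 + fps_nth E 2 = 0"
    using E1 by (simp add: eq)
  show "inv_log_coeff f 1 = - fps_nth F 2 / 2"
    using 1 by (simp add: H_def field_simps)
  have "fps_nth H 2 = - fps_nth F 3 + 3/2 * (fps_nth F 2)\<^sup>2"
    using 2 unfolding E2 1 by (simp add: field_simps power2_eq_square)
  then show "inv_log_coeff f 2 = - fps_nth F 3 / 2 + 3/4 * (fps_nth F 2)\<^sup>2"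
    by (simp add: H_def field_simps)
qed

section \<open>Coefficient bounds from the Cayley transform\<close>

lemma fps_nth_bound_unit_disc:
  assumes hol: "\<phi> holomorphic_on ball 0 1" and bd: "\<And>z. z \<in> ball 0 1 \<Longrightarrow> cmod (\<phi> z) \<le> 1"
    and exp: "\<phi> has_fps_expansion P"
  shows "cmod (fps_nth P n) \<le> 1"
proof -
  have P: "fps_nth P n = (deriv ^^ n) \<phi> 0 / fact n"
    by (rule fps_nth_fps_expansion[OF exp])
  have *: "cmod (fps_nth P n) * r ^ n \<le> 1" if r: "0 < r" "r < 1" for r
  proof -
    have "cball 0 r \<subseteq> ball (0::complex) 1" using r by auto
    then have "\<phi> holomorphic_on cball 0 r"
      using hol holomorphic_on_subset by blast
    then have "cmod ((deriv ^^ n) \<phi> 0) \<le> fact n * 1 / r ^ n"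
      using r bd by (intro Cauchy_inequality)
        (auto intro: holomorphic_on_subset holomorphic_on_imp_continuous_on)
    then show ?thesis
      using r by (simp add: P norm_divide field_simps)
  qed
  have "((\<lambda>r::real. cmod (fps_nth P n) * r ^ n) \<longlongrightarrow> cmod (fps_nth P n) * 1 ^ n) (at_left 1)"
    by (intro tendsto_intros)
  moreover have "\<forall>\<^sub>F r::real in at_left 1. cmod (fps_nth P n) * r ^ n \<le> 1"
    using eventually_at_left_real[of 0 "1::real"] by (auto elim!: eventually_mono intro: *)
  ultimately show ?thesis
    using tendsto_upperbound[of _ "cmod (fps_nth P n) * 1 ^ n" "at_left (1::real)" 1] by simp
qed

lemma norm_cayley_le_1:
  fixes a b :: complex
  assumes "Re (a / b) > 0"
  shows "a + b \<noteq> 0" and "cmod ((a - b) / (a + b)) \<le> 1"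
proof -
  have b: "b \<noteq> 0" using assms by auto
  define p where "p = a / b"
  have a: "a = p * b" using b by (simp add: p_def)
  have p: "Re p > 0" using assms by (simp add: p_def)
  have "p + 1 \<noteq> 0" using p by (auto simp: complex_eq_iff)
  moreover have ab: "a + b = (p + 1) * b" "a - b = (p - 1) * b"
    by (simp_all add: a algebra_simps)
  ultimately show "a + b \<noteq> 0" using b by simp
  have "cmod (p - 1) \<le> cmod (p + 1)"
    using p by (simp add: cmod_def power2_eq_square algebra_simps)
  then show "cmod ((a - b) / (a + b)) \<le> 1"
    using \<open>p + 1 \<noteq> 0\<close> b by (simp add: ab norm_divide)
qed

text \<open>
  The two bounded quantities are the coefficients of \<open>z\<close> and \<open>z\<^sup>2\<close> of the function
  \<open>\<phi> = (f' - q) / (f' + q)\<close>, which maps the unit disc into the closed unit disc.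
\<close>

lemma starlike_sym_coeff_bounds:
  assumes f: "f \<in> starlike_sym" and F: "f has_fps_expansion F"
  shows "cmod (fps_nth F 2) \<le> 1" and "cmod (fps_nth F 3 - (fps_nth F 2)\<^sup>2) \<le> 1"
proof -
  have fA: "f \<in> class_A" and re: "\<And>z. z \<in> ball 0 1 \<Longrightarrow> Re (starlike_sym_quot f z) > 0"
    using f by (auto simp: starlike_sym_def)
  have hol: "f holomorphic_on ball 0 1" and f0: "f 0 = 0" and d0: "deriv f 0 = 1"
    using fA by (auto simp: class_A_def)
  have FE: "F = fps_expansion f 0"
    using fps_expansion_unique_complex[OF F class_A_has_fps_expansion(1)[OF fA]] .
  have F0: "fps_nth F 0 = 0" and F1: "fps_nth F 1 = 1"
    using class_A_has_fps_expansion[OF fA] FE by auto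
  \<comment> \<open>The value \<open>1\<close> at the origin removes the singularity, since \<open>f' 0 = 1\<close>.\<close>
  define q where "q = (\<lambda>z. if z = 0 then 1 else (f z - f (- z)) / (2 * z))"
  define \<phi> where "\<phi> = (\<lambda>z. (deriv f z - q z) / (deriv f z + q z))"
  have holm: "(\<lambda>z. f (- z)) holomorphic_on ball 0 1"
    using holomorphic_on_compose_gen[OF holomorphic_on_minus[OF holomorphic_on_ident] hol]
    by (simp add: o_def image_subset_iff)
  have D: "(f has_field_derivative 1) (at 0)"
    using holomorphic_derivI[OF hol, of 0] d0 by simp
  have D2: "((\<lambda>z. (f z - f (- z)) / 2) has_field_derivative 1) (at 0)"
    using D by (auto intro!: derivative_eq_intros DERIV_chain2[where f = f])
  have holq: "q holomorphic_on ball 0 1"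
  proof -
    have "(\<lambda>z. (f z - f (- z)) / 2) holomorphic_on ball 0 1"
      using hol holm by (intro holomorphic_intros) auto
    then show ?thesis
      using pole_theorem_open_0[OF _ open_ball, of "\<lambda>z. (f z - f (- z)) / 2" 0 1 0 q]
        DERIV_imp_deriv[OF D2] by (simp add: q_def)
  qed
  have hold: "deriv f holomorphic_on ball 0 1"
    using hol by (intro holomorphic_deriv) auto
  have repos: "Re (deriv f z / q z) > 0" if "z \<in> ball 0 1" for z
  proof -
    have "deriv f z / q z = 2 * starlike_sym_quot f z"
      by (auto simp: starlike_sym_quot_def q_def d0)
    then show ?thesis using re[OF that] by simp
  qed
  have hol\<phi>: "\<phi> holomorphic_on ball 0 1"
    unfolding \<phi>_def using norm_cayley_le_1(1)[OF repos]
    by (intro holomorphic_on_divide holomorphic_on_add holomorphic_on_diff hold holq)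
  have bd: "cmod (\<phi> z) \<le> 1" if "z \<in> ball 0 1" for z
    unfolding \<phi>_def using norm_cayley_le_1(2)[OF repos[OF that]] .
  have exps: "h has_fps_expansion fps_expansion h 0" if "h holomorphic_on ball 0 1" for h
    using that by (intro analytic_at_imp_has_fps_expansion_0)
      (auto simp: analytic_at intro!: exI[of _ "ball 0 1"])
  define P where "P = fps_expansion \<phi> 0"
  define Q where "Q = fps_expansion q 0"
  have P: "\<phi> has_fps_expansion P" and Q: "q has_fps_expansion Q"
    using exps hol\<phi> holq by (auto simp: P_def Q_def)
  have dF: "deriv f has_fps_expansion fps_deriv F"
    using F by (rule has_fps_expansion_deriv)
  have Fm: "(\<lambda>z. f (- z)) has_fps_expansion (F oo (- fps_X))"
    using has_fps_expansion_compose[OF F, of uminus "- fps_X"]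
      has_fps_expansion_minus[OF has_fps_expansion_fps_X] by (simp add: o_def)
  have "(\<lambda>z. 2 * z * q z) has_fps_expansion fps_const 2 * fps_X * Q"
    by (intro has_fps_expansion_mult has_fps_expansion_const has_fps_expansion_fps_X Q)
  moreover have "(\<lambda>z. 2 * z * q z) = (\<lambda>z. f z - f (- z))"
    by (auto simp: q_def f0)
  moreover have "(\<lambda>z. f z - f (- z)) has_fps_expansion (F - (F oo (- fps_X)))"
    using F Fm by (rule has_fps_expansion_diff)
  ultimately have QF: "fps_const 2 * fps_X * Q = F - (F oo (- fps_X))"
    using fps_expansion_unique_complex by metis
  have Qn: "2 * fps_nth Q n = fps_nth F (Suc n) - (-1) ^ Suc n * fps_nth F (Suc n)" for n
    using arg_cong[OF QF, of "\<lambda>A. fps_nth A (Suc n)"]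
    by (simp add: mult.assoc fps_compose_uminus')
  have Qs: "fps_nth Q 0 = 1" "fps_nth Q 1 = 0" "fps_nth Q 2 = fps_nth F 3"
    using Qn[of 0] Qn[of 1] Qn[of 2] F1 by (simp_all add: numeral_3_eq_3)
  have "(\<lambda>z. \<phi> z * (deriv f z + q z)) has_fps_expansion P * (fps_deriv F + Q)"
    by (intro has_fps_expansion_mult has_fps_expansion_add P Q dF)
  moreover have "\<forall>\<^sub>F z in nhds 0. \<phi> z * (deriv f z + q z) = deriv f z - q z"
  proof (rule eventually_mono)
    show "\<forall>\<^sub>F z in nhds 0. z \<in> ball (0::complex) 1"
      by (rule eventually_nhds_in_open) auto
  qed (use norm_cayley_le_1(1)[OF repos] in \<open>simp add: \<phi>_def\<close>)
  ultimately have "(\<lambda>z. deriv f z - q z) has_fps_expansion P * (fps_deriv F + Q)"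
    using has_fps_expansion_cong by fastforce
  then have eq: "P * (fps_deriv F + Q) = fps_deriv F - Q"
    using fps_expansion_unique_complex has_fps_expansion_diff[OF dF Q] by blast
  have P0: "fps_nth P 0 = 0"
    using arg_cong[OF eq, of "\<lambda>A. fps_nth A 0"] F1 Qs by simp
  have P1: "fps_nth P 1 = fps_nth F 2"
    using arg_cong[OF eq, of "\<lambda>A. fps_nth A 1"] F1 Qs P0
    by (simp add: fps_mult_nth numeral_2_eq_2)
  have "fps_nth (P * (fps_deriv F + Q)) 2 = 2 * fps_nth P 2 + 2 * fps_nth P 1 * fps_nth F 2"
    using F1 Qs P0 by (simp add: fps_mult_nth numeral_2_eq_2)
  moreover have "fps_nth (fps_deriv F - Q) 2 = 2 * fps_nth F 3"
    using Qs by (simp add: numeral_3_eq_3 numeral_2_eq_2)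
  ultimately have "2 * fps_nth P 2 + 2 * fps_nth F 2 * fps_nth F 2 = 2 * fps_nth F 3"
    unfolding eq P1 by simp
  then have P2: "fps_nth P 2 = fps_nth F 3 - (fps_nth F 2)\<^sup>2"
    by algebra
  show "cmod (fps_nth F 2) \<le> 1"
    using fps_nth_bound_unit_disc[OF hol\<phi> bd P, of 1] P1 by simp
  show "cmod (fps_nth F 3 - (fps_nth F 2)\<^sup>2) \<le> 1"
    using fps_nth_bound_unit_disc[OF hol\<phi> bd P, of 2] P2 by simp
qed

section \<open>The sharp inequality\<close>

lemma starlike_sym_inv_log_coeff_bound:
  assumes f: "f \<in> starlike_sym"
  shows "cmod (inv_log_coeff f 2) - cmod (inv_log_coeff f 1) \<le> 1/2"
proof -
  have fA: "f \<in> class_A" using f by (simp add: starlike_sym_def)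
  define F where "F = fps_expansion f 0"
  have F: "f has_fps_expansion F"
    using class_A_has_fps_expansion(1)[OF fA] by (simp add: F_def)
  define x where "x = cmod (fps_nth F 2)"
  define b where "b = fps_nth F 3 - (fps_nth F 2)\<^sup>2"
  have x: "0 \<le> x" "x \<le> 1" and b: "cmod b \<le> 1"
    using starlike_sym_coeff_bounds[OF f F] by (auto simp: x_def b_def)
  have "inv_log_coeff f 2 = (fps_nth F 2)\<^sup>2 / 4 - b / 2"
    using inv_log_coeff_1_2(2)[OF fA F] by (simp add: b_def field_simps)
  then have "cmod (inv_log_coeff f 2) \<le> x\<^sup>2 / 4 + cmod b / 2"
    using norm_triangle_ineq4[of "(fps_nth F 2)\<^sup>2 / 4" "b / 2"]
    by (simp add: norm_divide norm_power x_def)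
  moreover have "cmod (inv_log_coeff f 1) = x / 2"
    using inv_log_coeff_1_2(1)[OF fA F] by (simp add: norm_divide x_def)
  moreover have "x\<^sup>2 \<le> x"
    using x by (simp add: power2_eq_square mult_left_le)
  ultimately show ?thesis
    using x b by simp
qed

lemma starlike_sym_extremal: "(\<lambda>z. z / (1 - z\<^sup>2)) \<in> starlike_sym"
proof -
  define f :: "complex \<Rightarrow> complex" where "f = (\<lambda>z. z / (1 - z\<^sup>2))"
  have nz: "1 - z\<^sup>2 \<noteq> 0" and lt: "cmod (z\<^sup>2) < 1" if "z \<in> ball 0 1" for z :: complex
  proof -
    show "cmod (z\<^sup>2) < 1"
      using that by (simp add: norm_power power_less_one_iff)
    then show "1 - z\<^sup>2 \<noteq> 0" by auto
  qed
  have D: "deriv f z = (1 + z\<^sup>2) / (1 - z\<^sup>2)\<^sup>2" if "z \<in> ball 0 1" for z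
    unfolding f_def using nz[OF that]
    by (intro DERIV_imp_deriv) (auto intro!: derivative_eq_intros simp: power2_eq_square field_simps)
  have "f holomorphic_on ball 0 1"
    unfolding f_def using nz by (intro holomorphic_intros) auto
  then have A: "f \<in> class_A"
    using D[of 0] by (simp add: class_A_def f_def)
  moreover have "Re (starlike_sym_quot f z) > 0" if z: "z \<in> ball 0 1" for z
  proof (cases "z = 0")
    case False
    define u where "u = z\<^sup>2"
    define v where "v = 1 - u"
    have u: "1 - u \<noteq> 0" "cmod u < 1" using nz[OF z] lt[OF z] by (auto simp: u_def)
    have "f z - f (- z) = 2 * z / v"
      by (simp add: f_def u_def v_def)
    moreover have "deriv f z = (1 + u) / v\<^sup>2"
      using D[OF z] by (simp add: u_def v_def)
    ultimately have "starlike_sym_quot f z = z * ((1 + u) / v\<^sup>2) / (2 * z / v)"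
      using False by (simp only: starlike_sym_quot_def if_False)
    also have "\<dots> = (1 + u) / v / 2"
      using False u(1) unfolding v_def[symmetric] by (simp add: power2_eq_square field_simps)
    finally have "Re (starlike_sym_quot f z) = Re ((1 + u) / v) / 2"
      by (simp only: Re_divide_numeral)
    also have "Re ((1 + u) / v) = (1 - (cmod u)\<^sup>2) / (cmod v)\<^sup>2"
      unfolding cmod_power2 Re_divide v_def by (simp add: power2_eq_square algebra_simps)
    also have "\<dots> / 2 > 0"
      using u by (simp add: power_less_one_iff v_def)
    finally show ?thesis .
  qed (simp add: starlike_sym_quot_def)
  ultimately show ?thesis
    by (simp add: starlike_sym_def f_def)
qed

lemma inv_log_coeff_extremal:
  "inv_log_coeff (\<lambda>z. z / (1 - z\<^sup>2)) 1 = 0" "inv_log_coeff (\<lambda>z. z / (1 - z\<^sup>2)) 2 = -1/2"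
proof -
  define f :: "complex \<Rightarrow> complex" where "f = (\<lambda>z. z / (1 - z\<^sup>2))"
  have fA: "f \<in> class_A"
    using starlike_sym_extremal by (simp add: starlike_sym_def f_def)
  define F :: "complex fps" where "F = fps_X / (1 - fps_X\<^sup>2)"
  have F: "f has_fps_expansion F"
    unfolding f_def F_def
    by (intro has_fps_expansion_divide' has_fps_expansion_diff has_fps_expansion_power
        has_fps_expansion_fps_X has_fps_expansion_1) simp
  have "F * (1 - fps_X\<^sup>2) = fps_X"
    by (simp add: F_def fps_divide_unit mult.assoc inverse_mult_eq_1)
  then have eq: "F = fps_X + F * fps_X\<^sup>2"
    by (simp add: algebra_simps)
  have "fps_nth F 0 = 0" "fps_nth F 1 = 1" "fps_nth F 2 = 0" "fps_nth F 3 = 1"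
  proof -
    show "fps_nth F 0 = 0" by (subst eq) simp
    then show "fps_nth F 2 = 0" by (subst eq) (simp add: fps_X_power_mult_right_nth)
    show 1: "fps_nth F 1 = 1" by (subst eq) (simp add: fps_X_power_mult_right_nth)
    show "fps_nth F 3 = 1" using 1 by (subst eq) (simp add: fps_X_power_mult_right_nth)
  qed
  then show "inv_log_coeff (\<lambda>z. z / (1 - z\<^sup>2)) 1 = 0" "inv_log_coeff (\<lambda>z. z / (1 - z\<^sup>2)) 2 = -1/2"
    using inv_log_coeff_1_2[OF fA F] by (simp_all add: f_def)
qed

theorem theorem2p1:
  shows "(\<forall>f\<in>starlike_sym. cmod (inv_log_coeff f 2) - cmod (inv_log_coeff f 1) \<le> 1/2) \<and>
         (\<exists>f\<in>starlike_sym. cmod (inv_log_coeff f 2) - cmod (inv_log_coeff f 1) = 1/2)"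
proof
  show "\<forall>f\<in>starlike_sym. cmod (inv_log_coeff f 2) - cmod (inv_log_coeff f 1) \<le> 1/2"
    using starlike_sym_inv_log_coeff_bound by blast
  show "\<exists>f\<in>starlike_sym. cmod (inv_log_coeff f 2) - cmod (inv_log_coeff f 1) = 1/2"
    using inv_log_coeff_extremal
    by (intro bexI[OF _ starlike_sym_extremal]) (simp add: norm_divide)
qed

end
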